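(* For every even integer $n\ge 16$, $$C_{\mathbb{C},n}=\frac{2^{\frac{n}{8}+\frac{67}{n}+\frac34}}{\pi^{\frac{36}{n}+\frac12}}\cdot\left(\prod_{k=1}^{6}\Gamma\left(\frac{6k+1}{4k+2}\right)^{2k+1}\right)^{1/n} r_n.$$
   Context: $\Gamma$ is the Gamma function. The numbers $C_{\mathbb{C},n}$ (estimates for the constants in the complex Bohnenblust--Hille inequality) are defined here for even $n\geq 2$ as follows: $C_{\mathbb{C},n}=\left(\frac{2}{\sqrt{\pi}}\right)^{n-1}$ for $n=2,4,6$; $$C_{\mathbb{C},n}=\frac{1}{\pi^{1/n}}\,2^{\frac{n+4}{2n}}\left(C_{\mathbb{C},n-2}\right)^{\frac{n-2}{n}}\quad\text{for } n=8,10,12,14$$ (so that $C_{\mathbb{C},14}=2^{30/7}/\pi^{19/14}$); and $$C_{\mathbb{C},n}=\frac{2^{\frac{n+2}{2n}}}{\pi^{1/n}}\left(\frac{1}{A_{\frac{2n-4}{n-1}}^{2}}\right)^{\frac{n-2}{n}}\left(C_{\mathbb{C},n-2}\right)^{\frac{n-2}{n}}\quad\text{for even } n\ge 16,$$ where $A_p=\sqrt{2}\left(\frac{\Gamma((p+1)/2)}{\sqrt{\pi}}\right)^{1/p}$. For even positive integers $n$ define $$r_n=\frac{1}{2^{\frac{n-2}{4}}\left[\prod_{k=1}^{\frac{n-2}{2}}\left(\frac{\Gamma\left(\frac{6k+1}{4k+2}\right)}{\sqrt{\pi}}\right)^{2k+1}\right]^{1/n}}$$ (an empty product equals $1$). 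*)

theory Defs
  imports "HOL-Analysis.Gamma_Function"
begin

definition A :: "real \<Rightarrow> real" where
  "A p = sqrt 2 * (Gamma ((p + 1) / 2) / sqrt pi) powr (1 / p)"

(* The constants are only defined for even n \<ge> 2; all other arguments are left unspecified. *)
fun C_complex :: "nat \<Rightarrow> real" where
  "C_complex n =
    (if odd n \<or> n = 0 then undefined
     else if n \<le> 6 then (2 / sqrt pi) ^ (n - 1)
     else if n \<le> 14 then
       1 / pi powr (1 / real n) * 2 powr ((real n + 4) / (2 * real n))
         * C_complex (n - 2) powr ((real n - 2) / real n)
     else
       2 powr ((real n + 2) / (2 * real n)) / pi powr (1 / real n)
         * (1 / (A ((2 * real n - 4) / (real n - 1)))\<^sup>2) powr ((real n - 2) / real n)
         * C_complex (n - 2) powr ((real n - 2) / real n))"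

declare C_complex.simps [simp del]

definition r :: "nat \<Rightarrow> real" where
  "r n = 1 / (2 powr ((real n - 2) / 4) *
     (\<Prod>k = 1..(n - 2) div 2.
        (Gamma ((6 * real k + 1) / (4 * real k + 2)) / sqrt pi) ^ (2 * k + 1)) powr (1 / real n))"

end

(* Taking logarithms, the recursion becomes additive in n * ln C_n: each step adds an explicit
   multiple of ln 2 and ln pi and, for n >= 16, the term -(n-1) ln Gamma((6k+1)/(4k+2)) with
   k = (n-2)/2, because p = (2n-4)/(n-1) satisfies (p+1)/2 = (6k+1)/(4k+2) and 2(n-2)/p = n-1.
   The claimed formula satisfies the same recursion, and already holds at n = 14. *)
theory Submission
  imports Defs
begin

lemma A_pos:
  assumes "p > -1"
  shows "A p > 0"
proof -
  have "Gamma ((p + 1) / 2) > 0"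
    using assms by (intro Gamma_real_pos) simp
  then show ?thesis by (simp add: A_def)
qed

text \<open>The bound on \<open>p\<close> keeps the Gamma argument positive. The case
  \<open>p = 0\<close> is covered too: division by zero gives 0, so both sides reduce to
  \<open>ln 2 / 2\<close>.\<close>

lemma ln_A:
  assumes "p > -1"
  shows "ln (A p) = ln 2 / 2 + (ln (Gamma ((p + 1) / 2)) - ln pi / 2) / p"
proof -
  have "Gamma ((p + 1) / 2) > 0"
    using assms by (intro Gamma_real_pos) simp
  then show ?thesis
    by (simp add: A_def ln_mult ln_div ln_powr ln_sqrt)
qed

lemma Gamma_node_pos: "Gamma ((6 * real k + 1) / (4 * real k + 2)) > 0"
  by (intro Gamma_real_pos divide_pos_pos) auto

lemma ln_prod_odd_power:
  fixes f :: "nat \<Rightarrow> real"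
  assumes "\<And>k. f k > 0"
  shows "ln (\<Prod>k\<in>S. f k ^ (2 * k + 1)) = (\<Sum>k\<in>S. (2 * real k + 1) * ln (f k))"
proof (cases "finite S")
  case True
  have "f k \<noteq> 0" for k
    using assms[of k] by simp
  moreover have "ln (f k ^ (2 * k + 1)) = (2 * real k + 1) * ln (f k)" for k
    using assms[of k] by (subst ln_realpow) simp_all
  ultimately show ?thesis
    using True by (subst ln_prod) (auto simp del: power_Suc intro!: sum.cong)
\<comment> \<open>For infinite \<open>S\<close> the product defaults to 1 and the sum to 0.\<close>
qed simp

lemma C_complex_6: "C_complex 6 = (2 / sqrt pi) ^ 5"
  by (subst C_complex.simps) simp

text \<open>Positivity lets \<open>ln\<close> turn the recursive products and powers into sums, and
  finally lets equal logarithms give equal numbers.\<close>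

lemma C_complex_pos:
  assumes "even n" "n > 0"
  shows "C_complex n > 0"
  using assms
proof (induction n rule: less_induct)
  case (less n)
  show ?case
  proof (cases "n \<le> 6")
    case True
    with less.prems show ?thesis by (subst C_complex.simps) simp
  next
    case False
    with less have prev: "C_complex (n - 2) > 0" by simp
    have "(2 * real n - 4) / (real n - 1) > 0"
      using False by simp
    then have "A ((2 * real n - 4) / (real n - 1)) > 0"
      by (intro A_pos) linarith
    with prev False less.prems show ?thesis by (subst C_complex.simps) simp
  qed
qed

lemma ln_C_complex_mid:
  assumes "even n" "6 < n" "n \<le> 14"
  shows "n * ln (C_complex n) =
    (real n + 4) / 2 * ln 2 - ln pi + real (n - 2) * ln (C_complex (n - 2))"
proof -
  have prev: "C_complex (n - 2) > 0"
    using assms by (intro C_complex_pos) auto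
  have "ln (C_complex n) = - ln pi / n + (real n + 4) / (2 * n) * ln 2
      + (real n - 2) / n * ln (C_complex (n - 2))"
    using assms prev by (subst C_complex.simps) (simp add: ln_mult ln_div ln_powr)
  then show ?thesis
    using assms by (simp add: of_nat_diff distrib_left right_diff_distrib)
qed

text \<open>The power of \<open>A p\<close> contributes \<open>- 2 * (n - 2) * ln (A p)\<close>. Its
  factor \<open>sqrt 2\<close> yields the \<open>- (n - 2) * ln 2\<close>, and its Gamma factor gets
  the weight \<open>2 * (n - 2) / p\<close>.\<close>

lemma ln_C_complex_step:
  assumes "even n" "14 < n"
  shows "n * ln (C_complex n) =
    ((real n + 2) / 2 - (real n - 2)) * ln 2 - ln pi
    - (real n - 1) * (ln (Gamma ((3 * real n - 5) / (2 * real n - 2))) - ln pi / 2)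
    + real (n - 2) * ln (C_complex (n - 2))"
proof -
  define p where "p = (2 * real n - 4) / (real n - 1)"
  define g where "g = ln (Gamma ((3 * real n - 5) / (2 * real n - 2))) - ln pi / 2"
  have p: "p > 0" using assms by (simp add: p_def)
  have arg: "(p + 1) / 2 = (3 * real n - 5) / (2 * real n - 2)"
    using assms by (simp add: p_def divide_simps)
  have A: "A p > 0" "ln (A p) = ln 2 / 2 + g / p"
    using A_pos[of p] ln_A[of p] p unfolding arg g_def by auto
  have scale: "2 * (real n - 2) / p = real n - 1"
    using assms by (simp add: p_def divide_simps)
  have prev: "C_complex (n - 2) > 0"
    using assms by (intro C_complex_pos) auto
  have "C_complex n = 2 powr ((real n + 2) / (2 * real n)) / pi powr (1 / real n)
      * (1 / (A p)\<^sup>2) powr ((real n - 2) / real n)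
      * C_complex (n - 2) powr ((real n - 2) / real n)"
    using assms by (subst C_complex.simps) (simp add: p_def)
  then have "ln (C_complex n) = (real n + 2) / (2 * n) * ln 2 - ln pi / n
      - (real n - 2) / n * (2 * ln (A p)) + (real n - 2) / n * ln (C_complex (n - 2))"
    using A(1) prev by (simp add: ln_mult ln_div ln_powr ln_realpow)
  then have "n * ln (C_complex n) = (real n + 2) / 2 * ln 2 - ln pi
      - 2 * (real n - 2) * ln (A p) + real (n - 2) * ln (C_complex (n - 2))"
    using assms by (simp add: of_nat_diff distrib_left right_diff_distrib)
  also have "2 * (real n - 2) * ln (A p) = (real n - 2) * ln 2 + 2 * (real n - 2) / p * g"
    by (simp add: A(2) algebra_simps add_divide_distrib diff_divide_distrib)
  finally show ?thesis
    by (simp only: scale g_def) (simp add: algebra_simps)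
qed

text \<open>Here \<open>6 * ln (C_complex 6) = 30 * ln 2 - 15 * ln pi\<close>; the four steps up to
  14 add 6 + 7 + 8 + 9 = 30 times \<open>ln 2\<close> and subtract \<open>4 * ln pi\<close>.\<close>

lemma ln_C_complex_14: "14 * ln (C_complex 14) = 60 * ln 2 - 19 * ln pi"
  using ln_C_complex_mid[of 8] ln_C_complex_mid[of 10] ln_C_complex_mid[of 12]
    ln_C_complex_mid[of 14]
  by (simp add: C_complex_6 ln_realpow ln_div ln_sqrt)

text \<open>The recursion only produces Gamma terms with \<open>k\<close> at least 7. Starting the
  last sum at 1, to match \<open>r\<close>, is compensated by the sum up to 6 and by 24 in the
  coefficient of \<open>ln pi\<close>, since the weights 3, 5, ..., 13 add up to 48.\<close>

lemma ln_C_complex_closed: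
  assumes "7 \<le> m"
  shows "real (2 * m) * ln (C_complex (2 * m)) =
    (67 + 5 * real m / 2 - real m ^ 2 / 2) * ln 2 - (36 + real m) * ln pi
    + (\<Sum>k = 1..6. (2 * real k + 1) * ln (Gamma ((6 * real k + 1) / (4 * real k + 2))))
    - (\<Sum>k = 1..m - 1. (2 * real k + 1) *
        (ln (Gamma ((6 * real k + 1) / (4 * real k + 2))) - ln pi / 2))"
  using assms
proof (induction m rule: nat_induct_at_least)
  case base
  \<comment> \<open>With both sums written out the Gamma terms cancel, leaving 67 + 35/2 - 49/2 = 60
    and -43 + 24 = -19.\<close>
  have "{1..7 - 1 :: nat} = {1, 2, 3, 4, 5, 6}" "{1..6 :: nat} = {1, 2, 3, 4, 5, 6}"
    by auto
  then show ?case
    using ln_C_complex_14 by (simp add: algebra_simps)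
next
  case (Suc m)
  have arg: "(3 * real (2 * Suc m) - 5) / (2 * real (2 * Suc m) - 2)
      = (6 * real m + 1) / (4 * real m + 2)"
    by (simp add: algebra_simps)
  \<comment> \<open>Resolves the truncated \<open>m - 1\<close>, so that the top term
    \<open>k = m\<close> can be split off.\<close>
  obtain j where j: "m = Suc j"
    using Suc.hyps by (cases m) auto
  have sum: "(\<Sum>k = 1..Suc m - 1. f k) = (\<Sum>k = 1..m - 1. f k) + f m" for f :: "nat \<Rightarrow> real"
    by (simp add: j)
  have "real (2 * Suc m) * ln (C_complex (2 * Suc m)) = (2 - real m) * ln 2 - ln pi
      - (2 * real m + 1) * (ln (Gamma ((6 * real m + 1) / (4 * real m + 2))) - ln pi / 2)
      + real (2 * m) * ln (C_complex (2 * m))"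
    using ln_C_complex_step[of "2 * Suc m"] Suc.hyps unfolding arg by (simp add: field_simps)
  moreover have "(67 + 5 * real (Suc m) / 2 - real (Suc m) ^ 2 / 2) * ln 2 - (36 + real (Suc m)) * ln pi
      = (67 + 5 * real m / 2 - real m ^ 2 / 2) * ln 2 - (36 + real m) * ln pi + (2 - real m) * ln 2 - ln pi"
    by (simp add: field_simps power2_eq_square)
  ultimately show ?case
    using Suc.IH unfolding sum by linarith
qed

theorem mainTheorem5:
  fixes n :: nat
  assumes "even n" and "n \<ge> 16"
  shows "C_complex n =
    2 powr (real n / 8 + 67 / real n + 3 / 4) / pi powr (36 / real n + 1 / 2)
      * (\<Prod>k = 1..6. Gamma ((6 * real k + 1) / (4 * real k + 2)) ^ (2 * k + 1)) powr (1 / real n)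
      * r n"
proof -
  obtain m where m: "n = 2 * m" using assms(1) by (elim evenE)
  with assms have m8: "m \<ge> 8" by simp
  let ?G = "\<lambda>k. Gamma ((6 * real k + 1) / (4 * real k + 2))"
  define P where "P = (\<Prod>k = 1..6. ?G k ^ (2 * k + 1))"
  define Q where "Q = (\<Prod>k = 1..m - 1. (?G k / sqrt pi) ^ (2 * k + 1))"
  have G: "?G k > 0" for k by (rule Gamma_node_pos)
  have P: "P > 0" unfolding P_def by (intro prod_pos ballI zero_less_power G)
  have Q: "Q > 0" unfolding Q_def by (intro prod_pos ballI zero_less_power divide_pos_pos G) simp
  have lnP: "ln P = (\<Sum>k = 1..6. (2 * real k + 1) * ln (?G k))"
    unfolding P_def by (intro ln_prod_odd_power G)
  have lnQ: "ln Q = (\<Sum>k = 1..m - 1. (2 * real k + 1) * (ln (?G k) - ln pi / 2))"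
    using ln_prod_odd_power[of "\<lambda>k. ?G k / sqrt pi"] G
    by (simp add: Q_def ln_div ln_sqrt less_imp_neq[OF G, symmetric])
  have half: "(n - 2) div 2 = m - 1" using m by simp
  have r: "r n = 1 / (2 powr ((real n - 2) / 4) * Q powr (1 / real n))"
    unfolding r_def half Q_def ..
  have closed: "ln (C_complex n) =
      ((67 + 5 * real m / 2 - real m ^ 2 / 2) * ln 2 - (36 + real m) * ln pi + ln P - ln Q) / n"
    using ln_C_complex_closed[of m] m8
    unfolding lnP[symmetric] lnQ[symmetric] m by (simp add: field_simps)
  define R where "R = 2 powr (real n / 8 + 67 / n + 3 / 4) / pi powr (36 / n + 1 / 2)
    * P powr (1 / n) * r n"
  have "R > 0" using P Q by (simp add: R_def r)
  have "ln R = (real n / 8 + 67 / n + 3 / 4) * ln 2 - (36 / n + 1 / 2) * ln pi + ln P / n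
      - ((real n - 2) / 4 * ln 2 + ln Q / n)"
    unfolding R_def r using P Q by (simp add: ln_mult ln_div ln_powr)
  \<comment> \<open>After scaling by \<open>n = 2 * m\<close>, the coefficient of
    \<open>ln 2\<close> is \<open>m^2 / 2 + 67 + 3 * m / 2 - (m^2 - m)\<close>, the quadratic of the
    closed form.\<close>
  also have "\<dots> = ln (C_complex n)"
    unfolding closed using m8 by (simp add: m field_simps power2_eq_square)
  finally have "C_complex n = R"
    using C_complex_pos[of n] \<open>R > 0\<close> assms by simp
  then show ?thesis
    unfolding R_def P_def .
qed

end
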